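(* Consider the semi-discrete hyperbolic curvature flow with $\beta=0$ and fixed zero boundary conditions, i.e. $\ddot{\vec U}=A\vec U$. Let $\{(\lambda_k,\phi_k)\}_{k=1}^{n-2}$ be the eigenpairs of $A$. The general solution $\vec U(t)$ for the interior vertices $i=2,\dots,n-1$ is $$U_i(t)=\sum_{k=1}^{n-2}\phi_{k,i}\big(C_k\cos(\omega_kt)+D_k\sin(\omega_kt)\big),$$ where $\omega_k=\sqrt{-\lambda_k}$ are the natural frequencies, $\phi_{k,i}$ is the component of the $k$-th eigenvector at vertex $i$, and $C_k,D_k\in\mathbb R^p$ are constant vectors determined by the initial configuration $\vec U(0)$ and $\frac{d\vec U}{dt}\big|_{t=0}$.
   Context: Fix integers $n\ge4$, $p\ge2$. $\vec U(t)=(U_2,\dots,U_{n-1})^\top$ with $U_i(t)\in\mathbb R^p$ is the $(n-2)\times p$ matrix of interior points of a piecewise linear curve with vertices $X_1,\dots,X_n$, whose end points are held fixed at $X_1=X_n=0$. $A=\mathrm{tridiag}(1,-2,1)$ is the $(n-2)\times(n-2)$ symmetric tridiagonal matrix with diagonal entries $-2$ and sub-/superdiagonal entries $1$ (it has $n-2$ distinct negative eigenvalues); $\phi_1,\dots,\phi_{n-2}$ is a basis of real eigenvectors with $A\phi_k=\lambda_k\phi_k$, whose components are indexed by the vertices $2,\dots,n-1$. "General solution" means every solution has this form and every function of this form is a solution. *)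

theory Defs
  imports "HOL-Analysis.Analysis"
begin

text \<open>
  The rows of a matrix of type \<open>real^'p^'m\<close> are the interior vertices of the curve. Since a finite
  index type carries no order, a bijection \<open>label\<close> from \<open>'m\<close> onto \<open>{2..n-1}\<close> gives the
  vertex number of each row.
\<close>

definition tridiag :: "('m::finite \<Rightarrow> nat) \<Rightarrow> real \<Rightarrow> real \<Rightarrow> real \<Rightarrow> real^'m^'m" where
  "tridiag label a b c =
     (\<chi> i j. if label i = label j + 1 then a
             else if label i = label j then b
             else if label j = label i + 1 then c
             else 0)"

text \<open>
  With \<open>A = tridiag label 1 (-2) 1\<close>, row \<open>i\<close> of \<open>A ** U\<close> is the second difference of the
  curve at vertex \<open>label i\<close>; the terms for the vertices 1 and \<open>n\<close> are missing because
  these are held at the origin.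
  At an endpoint of \<open>T\<close> the derivatives are one-sided, so that both \<open>T = UNIV\<close> and
  \<open>T = {0..}\<close> are covered.
\<close>

definition solves_flow ::
    "real^'m^'m \<Rightarrow> real set \<Rightarrow> (real \<Rightarrow> real^'p^'m) \<Rightarrow> bool" where
  "solves_flow A T U \<longleftrightarrow>
     (\<exists>V. \<forall>t\<in>T. (U has_vector_derivative V t) (at t within T) \<and>
                (V has_vector_derivative A ** U t) (at t within T))"

definition mode_sum ::
    "nat \<Rightarrow> (nat \<Rightarrow> real) \<Rightarrow> (nat \<Rightarrow> real^'m) \<Rightarrow> (nat \<Rightarrow> real^'p) \<Rightarrow> (nat \<Rightarrow> real^'p)
      \<Rightarrow> real \<Rightarrow> real^'p^'m" where
  "mode_sum N \<omega> \<phi> C D t =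
     (\<chi> i. \<Sum>k=1..N. (\<phi> k $ i) *\<^sub>R (cos (\<omega> k * t) *\<^sub>R C k + sin (\<omega> k * t) *\<^sub>R D k))"

end

theory Submission
  imports Defs
begin

text \<open>
  The matrix equation \<open>U'' = A U\<close> decouples in a basis of eigenvectors. Each column of \<open>U\<close> is
  expanded in the basis \<open>\<phi>\<close>, and the coefficients of \<open>\<phi> k\<close> in all columns are collected in one vector
  \<open>c\<close> of \<open>real^'p\<close>. Taking this coordinate is linear and turns multiplication by \<open>A\<close> into
  multiplication by the \<open>k\<close>-th eigenvalue (\<open>coord_matrix_mult\<close>), so that \<open>c'' = \<mu> c\<close> with \<open>\<mu>\<close> that
  eigenvalue.

  The eigenvalues are negative (\<open>tridiag_eigenvalue_negative\<close>), because a nonzero solution of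
  \<open>f (j - 1) - 2 f j + f (j + 1) = \<mu> f j\<close> with \<open>\<mu> \<ge> 0\<close> that starts at zero moves away from zero and
  so cannot satisfy the second boundary condition. Hence \<open>\<mu> = - \<omega>\<^sup>2\<close> with \<open>\<omega> > 0\<close>, every coordinate is a
  harmonic oscillator, and \<open>harmonic_oscillator\<close> gives
  \<open>c t = cos (\<omega> t) c 0 + sin (\<omega> t) (c' 0 / \<omega>)\<close>. Reassembling the columns yields the mode sum with
  amplitudes \<open>C = c 0\<close> and \<open>D = c' 0 / \<omega>\<close>.

  Conversely, differentiating a mode sum gives a mode sum with the amplitudes \<open>(\<omega> D, - \<omega> C)\<close>;
  doing it twice gives \<open>(- \<omega>\<^sup>2 C, - \<omega>\<^sup>2 D)\<close>, which is the effect of \<open>A\<close>. Since the coordinates of a mode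
  sum and of its derivative at time 0 are \<open>C\<close> and \<open>\<omega> D\<close>, the initial position and velocity determine
  the amplitudes. Here the interval must contain more than one point, for otherwise the derivative
  at 0 within it is not unique.
\<close>

section \<open>Negativity of the eigenvalues of the second difference matrix\<close>

text \<open>
  A discrete maximum principle. If, say, \<open>f 2 > 0\<close>, then the increments of \<open>f\<close> never decrease as long
  as \<open>f\<close> is nonnegative, so \<open>f\<close> keeps growing and cannot return to 0.
\<close>

lemma dirichlet_recursion_nonneg_trivial:
  fixes f :: "nat \<Rightarrow> real"
  assumes "f 1 = 0" and "f n = 0" and "n \<ge> 2" and "\<mu> \<ge> 0"
    and recursion: "\<And>j. 2 \<le> j \<Longrightarrow> j < n \<Longrightarrow> f (j - 1) - 2 * f j + f (j + 1) = \<mu> * f j"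
    and "1 \<le> j" and "j \<le> n"
  shows "f j = 0"
proof -
  \<comment> \<open>Multiplying by \<open>f 2\<close> treats both signs of \<open>f 2\<close> at once; the two estimates need each other in the
    induction step.\<close>
  have growth: "f 2 * f 2 \<le> f 2 * (f (Suc j) - f j) \<and> f 2 * f 2 \<le> f 2 * f (Suc j)"
    if "1 \<le> j" "j < n" for j
    using that
  proof (induction j rule: dec_induct)
    case base
    show ?case using \<open>f 1 = 0\<close> by (simp add: numeral_2_eq_2)
  next
    case (step j)
    then have "f (Suc (Suc j)) - f (Suc j) = f (Suc j) - f j + \<mu> * f (Suc j)"
      using recursion[of "Suc j"] by simp
    then have "f 2 * (f (Suc (Suc j)) - f (Suc j)) = f 2 * (f (Suc j) - f j + \<mu> * f (Suc j))"
      by (simp only:)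
    also have "\<dots> = f 2 * (f (Suc j) - f j) + \<mu> * (f 2 * f (Suc j))"
      by (simp add: algebra_simps)
    finally have "f 2 * (f (Suc (Suc j)) - f (Suc j)) = \<dots>" .
    moreover have IH: "f 2 * f 2 \<le> f 2 * (f (Suc j) - f j)" "f 2 * f 2 \<le> f 2 * f (Suc j)"
      using step by auto
    moreover have "0 \<le> f 2 * f 2" by simp
    moreover have "0 \<le> \<mu> * (f 2 * f (Suc j))"
      using IH(2) \<open>\<mu> \<ge> 0\<close> \<open>0 \<le> f 2 * f 2\<close> by (intro mult_nonneg_nonneg[of \<mu>]) linarith+
    ultimately show ?case unfolding right_diff_distrib by linarith
  qed
  have "f 2 * f 2 \<le> 0"
    using growth[of "n - 1"] \<open>n \<ge> 2\<close> \<open>f n = 0\<close> by simp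
  then have "f 2 = 0"
    by (metis mult_eq_0_iff order_antisym zero_le_square)
  have "f j = 0 \<and> (j < n \<longrightarrow> f (Suc j) = 0)"
    using \<open>1 \<le> j\<close> \<open>j \<le> n\<close>
  proof (induction j rule: dec_induct)
    case base
    show ?case using \<open>f 1 = 0\<close> \<open>f 2 = 0\<close> by (simp add: numeral_2_eq_2)
  next
    case (step j)
    then show ?case using recursion[of "Suc j"] by simp
  qed
  then show ?thesis by blast
qed

text \<open>
  Extending \<open>v\<close> by zero to the two end points accounts for the entries that are missing in the first and
  the last row, so that all rows have the same form.
\<close>

lemma second_difference_matrix_vector:
  fixes label :: "'m::finite \<Rightarrow> nat" and v :: "real^'m"
  assumes label: "bij_betw label (UNIV :: 'm set) {2..n - 1}"
    and f: "\<And>i. f (label i) = v $ i"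
    and zero: "f 1 = 0" "f n = 0"
  shows "(tridiag label 1 (-2) 1 *v v) $ i = f (label i - 1) - 2 * f (label i) + f (label i + 1)"
proof -
  let ?a = "label i" and ?S = "{2..n - 1}"
  have a: "?a \<in> ?S"
    using label by (auto simp: bij_betw_def)
  have "(tridiag label 1 (-2) 1 *v v) $ i
      = (\<Sum>j\<in>UNIV. (if ?a - 1 = label j then f (label j) else 0)
          - (if ?a = label j then 2 * f (label j) else 0)
          + (if ?a + 1 = label j then f (label j) else 0))"
    unfolding matrix_vector_mult_def tridiag_def vec_lambda_beta f[symmetric]
    using a by (intro sum.cong) auto
  also have "\<dots> = (\<Sum>l\<in>?S. (if ?a - 1 = l then f l else 0)
          - (if ?a = l then 2 * f l else 0) + (if ?a + 1 = l then f l else 0))"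
    by (rule sum.reindex_bij_betw[OF label])
  also have "\<dots> = f (?a - 1) - 2 * f ?a + f (?a + 1)"
  proof -
    have "?a - 1 \<in> ?S \<or> ?a - 1 = 1" "?a + 1 \<in> ?S \<or> ?a + 1 = n"
      using a by auto
    then have "(if ?a - 1 \<in> ?S then f (?a - 1) else 0) = f (?a - 1)"
      "(if ?a + 1 \<in> ?S then f (?a + 1) else 0) = f (?a + 1)"
      using zero by auto
    then show ?thesis
      using a by (simp only: sum.distrib sum_subtractf sum.delta' finite_atLeastAtMost if_True)
  qed
  finally show ?thesis .
qed

text \<open>
  For \<open>\<mu> \<ge> 0\<close> the extension of an eigenvector by zero would be a nontrivial solution of the recursion
  excluded above.
\<close>

lemma tridiag_eigenvalue_negative:
  fixes label :: "'m::finite \<Rightarrow> nat" and v :: "real^'m"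
  assumes label: "bij_betw label (UNIV :: 'm set) {2..n - 1}"
    and eigen: "tridiag label 1 (-2) 1 *v v = \<mu> *\<^sub>R v" and "v \<noteq> 0"
  shows "\<mu> < 0"
proof (rule ccontr)
  assume "\<not> \<mu> < 0"
  define f where "f l = (if l \<in> {2..n - 1} then v $ inv label l else 0)" for l
  have "inj label" and range: "range label = {2..n - 1}"
    using label by (auto simp: bij_betw_def)
  then have f_label: "f (label i) = v $ i" for i
    by (auto simp: f_def)
  have ends: "f 1 = 0" "f n = 0"
    by (auto simp: f_def)
  have n: "n \<ge> 2"
    using range by (cases "n \<ge> 3") auto
  have rec: "f (l - 1) - 2 * f l + f (l + 1) = \<mu> * f l" if "2 \<le> l" "l < n" for l
  proof -
    have "l \<in> range label"
      using that range by auto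
    then obtain i where "l = label i" by blast
    then show ?thesis
      using second_difference_matrix_vector[where f = f, OF label f_label ends, of i] eigen f_label[of i] by simp
  qed
  have "v $ i = 0" for i
  proof -
    have "label i \<in> {2..n - 1}"
      using range by blast
    then show ?thesis
      using dirichlet_recursion_nonneg_trivial[of f n \<mu> "label i"] ends n rec f_label[of i] \<open>\<not> \<mu> < 0\<close>
      by fastforce
  qed
  with \<open>v \<noteq> 0\<close> show False
    by (simp add: vec_eq_iff)
qed

section \<open>The harmonic oscillator\<close>

text \<open>
  In phase space the motion is a rotation by the angle \<open>\<omega> t\<close>. Rotating back gives the two quantities
  \<open>a\<close> and \<open>b\<close> of the proof, which are constant in time, so that every solution is given by its values at 0.
\<close>

lemma harmonic_oscillator:
  fixes c v :: "real \<Rightarrow> 'a::real_normed_vector"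
  assumes "convex T" and "0 \<in> T" and "\<omega> \<noteq> 0"
    and c: "\<And>t. t \<in> T \<Longrightarrow> (c has_vector_derivative v t) (at t within T)"
    and v: "\<And>t. t \<in> T \<Longrightarrow> (v has_vector_derivative - (\<omega>\<^sup>2) *\<^sub>R c t) (at t within T)"
    and "t \<in> T"
  shows "c t = cos (\<omega> * t) *\<^sub>R c 0 + sin (\<omega> * t) *\<^sub>R (v 0 /\<^sub>R \<omega>)"
proof -
  define a where "a s = cos (\<omega> * s) *\<^sub>R c s - (sin (\<omega> * s) / \<omega>) *\<^sub>R v s" for s
  define b where "b s = sin (\<omega> * s) *\<^sub>R c s + (cos (\<omega> * s) / \<omega>) *\<^sub>R v s" for s
  have "(a has_vector_derivative 0) (at s within T)" if "s \<in> T" for s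
    unfolding a_def using \<open>\<omega> \<noteq> 0\<close>
    by (auto intro!: derivative_eq_intros c[OF that] v[OF that]
        simp: power2_eq_square field_simps simp flip: scaleR_add_left scaleR_diff_left)
  then have a: "a t = a 0"
    using has_vector_derivative_zero_constant[OF \<open>convex T\<close>] \<open>0 \<in> T\<close> \<open>t \<in> T\<close> by metis
  have "(b has_vector_derivative 0) (at s within T)" if "s \<in> T" for s
    unfolding b_def using \<open>\<omega> \<noteq> 0\<close>
    by (auto intro!: derivative_eq_intros c[OF that] v[OF that]
        simp: power2_eq_square field_simps simp flip: scaleR_add_left scaleR_diff_left)
  then have b: "b t = b 0"
    using has_vector_derivative_zero_constant[OF \<open>convex T\<close>] \<open>0 \<in> T\<close> \<open>t \<in> T\<close> by metis
  have "c t = (cos (\<omega> * t) * cos (\<omega> * t)) *\<^sub>R c t + (sin (\<omega> * t) * sin (\<omega> * t)) *\<^sub>R c t"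
    by (simp flip: scaleR_add_left power2_eq_square)
  also have "\<dots> = cos (\<omega> * t) *\<^sub>R a t + sin (\<omega> * t) *\<^sub>R b t"
    by (simp add: a_def b_def algebra_simps)
  also have "\<dots> = cos (\<omega> * t) *\<^sub>R c 0 + sin (\<omega> * t) *\<^sub>R (v 0 /\<^sub>R \<omega>)"
    unfolding a b by (simp add: a_def b_def divide_inverse)
  finally show ?thesis .
qed

section \<open>Mode sums\<close>

lemma mode_sum_cong:
  assumes "\<And>k. k \<in> {1..N} \<Longrightarrow> C k = C' k" "\<And>k. k \<in> {1..N} \<Longrightarrow> D k = D' k"
  shows "mode_sum N \<omega> \<phi> C D t = mode_sum N \<omega> \<phi> C' D' t"
  unfolding mode_sum_def using assms by simp

lemma column_mode_sum:
  "column j (mode_sum N \<omega> \<phi> C D t)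
    = (\<Sum>k=1..N. (cos (\<omega> k * t) *\<^sub>R C k + sin (\<omega> k * t) *\<^sub>R D k) $ j *\<^sub>R \<phi> k)"
  by (simp add: vec_eq_iff column_def mode_sum_def mult.commute)

lemma column_matrix_mult:
  fixes A :: "real^'l^'m"
  shows "column j (A ** B) = A *v column j B"
  by (simp add: vec_eq_iff column_def matrix_matrix_mult_def matrix_vector_mult_def)

lemma column_add: "column j (M + M') = column j M + column j M'"
  by (simp add: vec_eq_iff column_def)

lemma column_scaleR: "column j (r *\<^sub>R M) = r *\<^sub>R column j M"
  by (simp add: vec_eq_iff column_def)

lemma matrix_eq_columns:
  "M = M' \<longleftrightarrow> (\<forall>j. column j M = column j M')"
  by (auto simp: vec_eq_iff column_def)

text \<open>
  The derivative is again a mode sum, so one rule gives the velocity and the acceleration.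
\<close>

lemma mode_sum_has_vector_derivative:
  fixes C D :: "nat \<Rightarrow> real^'p" and \<phi> :: "nat \<Rightarrow> real^'m"
  shows "(mode_sum N \<omega> \<phi> C D has_vector_derivative
    mode_sum N \<omega> \<phi> (\<lambda>k. \<omega> k *\<^sub>R D k) (\<lambda>k. - \<omega> k *\<^sub>R C k) t) (at t within T)"
proof -
  \<comment> \<open>Pulling the time dependence out of the matrix entries leaves a finite sum of scalar functions times
    constant matrices of rank at most one.\<close>
  let ?E = "\<lambda>k (c :: real^'p). \<chi> i. \<phi> k $ i *\<^sub>R c"
  have expand: "mode_sum N \<omega> \<phi> C D
      = (\<lambda>t. \<Sum>k=1..N. cos (\<omega> k * t) *\<^sub>R ?E k (C k) + sin (\<omega> k * t) *\<^sub>R ?E k (D k))" for C D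
    by (simp add: fun_eq_iff vec_eq_iff mode_sum_def algebra_simps)
  have "((\<lambda>t. \<Sum>k=1..N. cos (\<omega> k * t) *\<^sub>R ?E k (C k) + sin (\<omega> k * t) *\<^sub>R ?E k (D k))
      has_vector_derivative
      (\<Sum>k=1..N. (- \<omega> k * sin (\<omega> k * t)) *\<^sub>R ?E k (C k) + (\<omega> k * cos (\<omega> k * t)) *\<^sub>R ?E k (D k)))
      (at t within T)"
    by (auto intro!: derivative_eq_intros has_vector_derivative_sum simp: mult.commute)
  moreover have "mode_sum N \<omega> \<phi> (\<lambda>k. \<omega> k *\<^sub>R D k) (\<lambda>k. - \<omega> k *\<^sub>R C k) t
      = (\<Sum>k=1..N. (- \<omega> k * sin (\<omega> k * t)) *\<^sub>R ?E k (C k) + (\<omega> k * cos (\<omega> k * t)) *\<^sub>R ?E k (D k))"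
    by (simp add: vec_eq_iff mode_sum_def algebra_simps)
  ultimately show ?thesis
    by (simp only: expand[of C D])
qed

section \<open>Decoupling in a basis of modes\<close>

text \<open>
  The abstract situation: \<open>A\<close> is diagonalisable over the reals and its eigenvalues \<open>- (\<omega> k)\<^sup>2\<close> are
  negative.
\<close>

locale oscillation_modes =
  fixes A :: "real^'m^'m" and \<omega> :: "nat \<Rightarrow> real" and \<phi> :: "nat \<Rightarrow> real^'m" and N :: nat
  assumes eigen: "k \<in> {1..N} \<Longrightarrow> A *v \<phi> k = - ((\<omega> k)\<^sup>2) *\<^sub>R \<phi> k"
    and frequency_pos: "k \<in> {1..N} \<Longrightarrow> \<omega> k > 0"
    and inj: "inj_on \<phi> {1..N}"
    and indep: "independent (\<phi> ` {1..N})"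
    and spanning: "span (\<phi> ` {1..N}) = UNIV"
begin

text \<open>
  The coefficients of the mode \<open>\<phi> k\<close> in the columns of \<open>M\<close> are collected in one vector, since the
  amplitudes of a mode sum are vectors too.
\<close>

definition coord :: "nat \<Rightarrow> real^'p^'m \<Rightarrow> real^'p" where
  "coord k M = (\<chi> j. representation (\<phi> ` {1..N}) (column j M) (\<phi> k))"

text \<open>
  The coefficients of a combination of basis vectors can be read off: coordinates indexed by the number
  \<open>k\<close> instead of the vector \<open>\<phi> k\<close>. Injectivity of \<open>\<phi>\<close> makes the two indexings agree.
\<close>

lemma representation_mode_combination:
  assumes "k \<in> {1..N}"
  shows "representation (\<phi> ` {1..N}) (\<Sum>l=1..N. r l *\<^sub>R \<phi> l) (\<phi> k) = r k"
proof -
  have "representation (\<phi> ` {1..N}) (\<Sum>l=1..N. r l *\<^sub>R \<phi> l) (\<phi> k)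
      = (\<Sum>l=1..N. r l * representation (\<phi> ` {1..N}) (\<phi> l) (\<phi> k))"
    using indep spanning by (simp add: representation_sum representation_scale)
  also have "\<dots> = (\<Sum>l=1..N. if l = k then r l else 0)"
    using indep inj assms by (intro sum.cong) (auto simp: representation_basis inj_on_eq_iff)
  also have "\<dots> = r k"
    using assms by simp
  finally show ?thesis .
qed

lemma mode_combination_representation:
  "(\<Sum>k=1..N. representation (\<phi> ` {1..N}) x (\<phi> k) *\<^sub>R \<phi> k) = x"
proof -
  have "(\<Sum>b\<in>\<phi> ` {1..N}. representation (\<phi> ` {1..N}) x b *\<^sub>R b) = x"
    using indep spanning by (intro sum_representation_eq) auto
  then show ?thesis
    using inj by (simp add: sum.reindex)
qed

lemma column_expansion: "column j M = (\<Sum>k=1..N. coord k M $ j *\<^sub>R \<phi> k)"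
  unfolding coord_def vec_lambda_beta by (rule mode_combination_representation[symmetric])

lemma bounded_linear_coord: "bounded_linear (coord k :: real^'p^'m \<Rightarrow> real^'p)"
proof -
  have "linear (coord k :: real^'p^'m \<Rightarrow> real^'p)"
  proof
    fix M M' :: "real^'p^'m" and r :: real
    show "coord k (M + M') = coord k M + coord k M'" "coord k (r *\<^sub>R M) = r *\<^sub>R coord k M"
      using indep spanning
      by (simp_all add: coord_def vec_eq_iff[where 'b = 'p] column_add column_scaleR
          representation_add representation_scale)
  qed
  then show ?thesis
    by (rule linear_conv_bounded_linear[THEN iffD1])
qed

lemma coord_mode_sum:
  assumes "k \<in> {1..N}"
  shows "coord k (mode_sum N \<omega> \<phi> C D t) = cos (\<omega> k * t) *\<^sub>R C k + sin (\<omega> k * t) *\<^sub>R D k"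
  unfolding coord_def column_mode_sum representation_mode_combination[OF assms]
  by (simp add: vec_eq_iff)

lemma matrix_mult_column_expansion:
  "column j (A ** M) = (\<Sum>k=1..N. (- ((\<omega> k)\<^sup>2) * coord k M $ j) *\<^sub>R \<phi> k)"
proof -
  have "column j (A ** M) = (\<Sum>k=1..N. coord k M $ j *\<^sub>R (A *v \<phi> k))"
    unfolding column_matrix_mult column_expansion[of j M]
    by (simp add: linear_sum[OF matrix_vector_mul_linear] linear_scale[OF matrix_vector_mul_linear])
  also have "\<dots> = (\<Sum>k=1..N. (- ((\<omega> k)\<^sup>2) * coord k M $ j) *\<^sub>R \<phi> k)"
    by (intro sum.cong) (auto simp: eigen)
  finally show ?thesis .
qed

text \<open>
  This is the decoupling: in the coordinates of the modes the matrix acts as a scalar on each one.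
\<close>

lemma coord_matrix_mult:
  assumes "k \<in> {1..N}"
  shows "coord k (A ** M) = - ((\<omega> k)\<^sup>2) *\<^sub>R coord k M"
  unfolding coord_def[of k "A ** M"] matrix_mult_column_expansion
    representation_mode_combination[OF assms]
  by (simp add: vec_eq_iff)

lemma matrix_mult_mode_sum:
  "A ** mode_sum N \<omega> \<phi> C D t
    = mode_sum N \<omega> \<phi> (\<lambda>k. - ((\<omega> k)\<^sup>2) *\<^sub>R C k) (\<lambda>k. - ((\<omega> k)\<^sup>2) *\<^sub>R D k) t"
  unfolding matrix_eq_columns matrix_mult_column_expansion column_mode_sum
  by (intro allI sum.cong refl) (simp add: coord_mode_sum algebra_simps)

text \<open>
  Differentiating twice multiplies both amplitudes of mode \<open>k\<close> by \<open>- (\<omega> k)\<^sup>2\<close>, and so does \<open>A\<close>.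
\<close>

lemma mode_sum_solves_flow:
  assumes U: "\<And>t. t \<in> T \<Longrightarrow> U t = mode_sum N \<omega> \<phi> C D t"
  shows "solves_flow A T U"
  unfolding solves_flow_def
proof (intro exI[of _ "mode_sum N \<omega> \<phi> (\<lambda>k. \<omega> k *\<^sub>R D k) (\<lambda>k. - \<omega> k *\<^sub>R C k)"] ballI conjI)
  fix t assume "t \<in> T"
  show "(U has_vector_derivative mode_sum N \<omega> \<phi> (\<lambda>k. \<omega> k *\<^sub>R D k) (\<lambda>k. - \<omega> k *\<^sub>R C k) t)
      (at t within T)"
    by (rule has_vector_derivative_transform[OF \<open>t \<in> T\<close> _ mode_sum_has_vector_derivative]) (rule U)
  show "(mode_sum N \<omega> \<phi> (\<lambda>k. \<omega> k *\<^sub>R D k) (\<lambda>k. - \<omega> k *\<^sub>R C k) has_vector_derivative A ** U t)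
      (at t within T)"
    unfolding U[OF \<open>t \<in> T\<close>] matrix_mult_mode_sum
    using mode_sum_has_vector_derivative[of N \<omega> \<phi> "\<lambda>k. \<omega> k *\<^sub>R D k" "\<lambda>k. - \<omega> k *\<^sub>R C k" t T]
    by (simp add: power2_eq_square)
qed

text \<open>
  Every coordinate of a solution is a harmonic oscillator, and a matrix is determined by its coordinates.
\<close>

lemma solution_eq_mode_sum:
  fixes U V :: "real \<Rightarrow> real^'p^'m"
  assumes "convex T" "0 \<in> T"
    and U: "\<And>t. t \<in> T \<Longrightarrow> (U has_vector_derivative V t) (at t within T)"
    and V: "\<And>t. t \<in> T \<Longrightarrow> (V has_vector_derivative A ** U t) (at t within T)"
    and "t \<in> T"
  shows "U t = mode_sum N \<omega> \<phi> (\<lambda>k. coord k (U 0)) (\<lambda>k. coord k (V 0) /\<^sub>R \<omega> k) t"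
proof -
  have "coord k (U t)
      = cos (\<omega> k * t) *\<^sub>R coord k (U 0) + sin (\<omega> k * t) *\<^sub>R (coord k (V 0) /\<^sub>R \<omega> k)"
    if k: "k \<in> {1..N}" for k
  proof (rule harmonic_oscillator[where c = "\<lambda>t. coord k (U t)" and v = "\<lambda>t. coord k (V t)",
        OF \<open>convex T\<close> \<open>0 \<in> T\<close> _ _ _ \<open>t \<in> T\<close>])
    show "\<omega> k \<noteq> 0"
      using frequency_pos[OF k] by simp
    fix s assume "s \<in> T"
    show "((\<lambda>t. coord k (U t)) has_vector_derivative coord k (V s)) (at s within T)"
      by (rule bounded_linear.has_vector_derivative[OF bounded_linear_coord U[OF \<open>s \<in> T\<close>]])
    show "((\<lambda>t. coord k (V t)) has_vector_derivative - ((\<omega> k)\<^sup>2) *\<^sub>R coord k (U s)) (at s within T)"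
      unfolding coord_matrix_mult[OF k, symmetric]
      by (rule bounded_linear.has_vector_derivative[OF bounded_linear_coord V[OF \<open>s \<in> T\<close>]])
  qed
  then show ?thesis
    unfolding matrix_eq_columns column_mode_sum column_expansion[of _ "U t"] by simp
qed

lemma solves_flow_iff_mode_sum:
  fixes U :: "real \<Rightarrow> real^'p^'m"
  assumes "convex T" "0 \<in> T"
  shows "solves_flow A T U \<longleftrightarrow> (\<exists>C D. \<forall>t\<in>T. U t = mode_sum N \<omega> \<phi> C D t)"
proof
  assume "solves_flow A T U"
  then obtain V where "\<And>t. t \<in> T \<Longrightarrow> (U has_vector_derivative V t) (at t within T)"
      "\<And>t. t \<in> T \<Longrightarrow> (V has_vector_derivative A ** U t) (at t within T)"
    unfolding solves_flow_def by blast
  from solution_eq_mode_sum[OF assms this] show "\<exists>C D. \<forall>t\<in>T. U t = mode_sum N \<omega> \<phi> C D t"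
    by (intro exI ballI)
next
  assume "\<exists>C D. \<forall>t\<in>T. U t = mode_sum N \<omega> \<phi> C D t"
  then show "solves_flow A T U"
    using mode_sum_solves_flow by blast
qed

lemma mode_sum_coord_0:
  assumes "\<And>k. k \<in> {1..N} \<Longrightarrow> C k = coord k M"
  shows "mode_sum N \<omega> \<phi> C D 0 = M"
  unfolding matrix_eq_columns column_mode_sum column_expansion[of _ M]
  using assms by simp

section \<open>The initial value problem\<close>

text \<open>
  The velocity \<open>V\<close> in the definition of a solution is existentially quantified. That 0 is a limit point
  of \<open>T\<close> ensures \<open>V 0 = V0\<close>, so that the prescribed velocity is the one that enters the amplitudes.
\<close>

lemma initial_value_problem_iff:
  fixes U :: "real \<Rightarrow> real^'p^'m"
  assumes "convex T" "0 \<in> T" and limpt: "at 0 within T \<noteq> bot"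
    and C: "\<And>k. k \<in> {1..N} \<Longrightarrow> C k = coord k U0"
    and D: "\<And>k. k \<in> {1..N} \<Longrightarrow> D k = coord k V0 /\<^sub>R \<omega> k"
  shows "solves_flow A T U \<and> U 0 = U0 \<and> (U has_vector_derivative V0) (at 0 within T)
    \<longleftrightarrow> (\<forall>t\<in>T. U t = mode_sum N \<omega> \<phi> C D t)"
proof
  assume *: "solves_flow A T U \<and> U 0 = U0 \<and> (U has_vector_derivative V0) (at 0 within T)"
  then obtain V where V: "\<And>t. t \<in> T \<Longrightarrow> (U has_vector_derivative V t) (at t within T)"
      "\<And>t. t \<in> T \<Longrightarrow> (V has_vector_derivative A ** U t) (at t within T)"
    unfolding solves_flow_def by blast
  have "V 0 = V0"
    using vector_derivative_unique_within[OF limpt V(1)[OF \<open>0 \<in> T\<close>]] * by blast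
  then show "\<forall>t\<in>T. U t = mode_sum N \<omega> \<phi> C D t"
    using solution_eq_mode_sum[OF \<open>convex T\<close> \<open>0 \<in> T\<close> V] * C D
    by (auto intro!: mode_sum_cong)
next
  assume U: "\<forall>t\<in>T. U t = mode_sum N \<omega> \<phi> C D t"
  have velocity: "mode_sum N \<omega> \<phi> (\<lambda>k. \<omega> k *\<^sub>R D k) (\<lambda>k. - \<omega> k *\<^sub>R C k) 0 = V0"
  proof (rule mode_sum_coord_0)
    fix k assume "k \<in> {1..N}"
    then show "\<omega> k *\<^sub>R D k = coord k V0"
      using D frequency_pos[of k] by simp
  qed
  have "(U has_vector_derivative V0) (at 0 within T)"
    unfolding velocity[symmetric]
    by (rule has_vector_derivative_transform[OF \<open>0 \<in> T\<close> _ mode_sum_has_vector_derivative]) (use U in auto)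
  then show "solves_flow A T U \<and> U 0 = U0 \<and> (U has_vector_derivative V0) (at 0 within T)"
    using U \<open>0 \<in> T\<close> mode_sum_solves_flow[of T U C D] mode_sum_coord_0[of C U0 D, OF C] by simp
qed

text \<open>
  Amplitudes with indices outside \<open>{1..N}\<close> do not occur in the mode sum; restricting to extensional
  functions on \<open>{1..N}\<close> removes this freedom and makes uniqueness literal. For uniqueness, the mode
  sum with the given amplitudes is itself one of the solutions that the equivalence speaks of, and
  its initial data give the amplitudes back.
\<close>

lemma amplitudes_determined_by_initial_data:
  fixes U0 V0 :: "real^'p^'m"
  assumes "convex T" "0 \<in> T" and limpt: "at 0 within T \<noteq> bot"
  shows "\<exists>!(C, D). C \<in> {1..N} \<rightarrow>\<^sub>E UNIV \<and> D \<in> {1..N} \<rightarrow>\<^sub>E UNIV \<and>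
    (\<forall>U :: real \<Rightarrow> real^'p^'m.
       solves_flow A T U \<and> U 0 = U0 \<and> (U has_vector_derivative V0) (at 0 within T) \<longleftrightarrow>
       (\<forall>t\<in>T. U t = mode_sum N \<omega> \<phi> C D t))"
    (is "\<exists>!(C, D). ?amplitudes C D")
proof -
  let ?C = "\<lambda>k\<in>{1..N}. coord k U0" and ?D = "\<lambda>k\<in>{1..N}. coord k V0 /\<^sub>R \<omega> k"
  have existence: "?amplitudes ?C ?D"
    using initial_value_problem_iff[OF assms, of ?C U0 ?D V0] by auto
  have uniqueness: "C = ?C \<and> D = ?D" if "?amplitudes C D" for C D
  proof -
    have ext: "C \<in> extensional {1..N}" "D \<in> extensional {1..N}"
      using that by (auto simp: PiE_def)
    have U0: "mode_sum N \<omega> \<phi> C D 0 = U0"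
      and V0: "(mode_sum N \<omega> \<phi> C D has_vector_derivative V0) (at 0 within T)"
      using that by blast+
    have V0': "mode_sum N \<omega> \<phi> (\<lambda>k. \<omega> k *\<^sub>R D k) (\<lambda>k. - \<omega> k *\<^sub>R C k) 0 = V0"
      by (rule vector_derivative_unique_within[OF limpt mode_sum_has_vector_derivative V0])
    have "C k = coord k U0" "D k = coord k V0 /\<^sub>R \<omega> k" if "k \<in> {1..N}" for k
      unfolding U0[symmetric] V0'[symmetric] coord_mode_sum[OF that]
      using frequency_pos[OF that] by simp_all
    with ext show ?thesis
      by (auto intro: extensionalityI)
  qed
  show ?thesis
    using existence uniqueness by (intro ex1I[of _ "(?C, ?D)"]) auto
qed

end

section \<open>The semi-discrete hyperbolic curvature flow\<close>

theorem proposition7: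
  fixes n :: nat
    and label :: "'m::finite \<Rightarrow> nat"
    and A :: "real^'m^'m"
    and \<mu> \<omega> :: "nat \<Rightarrow> real"
    and \<phi> :: "nat \<Rightarrow> real^'m"
    and T :: "real set"
  assumes "n \<ge> 4"
    and "CARD('p::finite) \<ge> 2"
    and "bij_betw label (UNIV :: 'm set) {2..n-1}"
    and "A = tridiag label 1 (-2) 1"
    and "\<And>k. k \<in> {1..n-2} \<Longrightarrow> A *v \<phi> k = \<mu> k *\<^sub>R \<phi> k"
    and "inj_on \<phi> {1..n-2}"
    and "independent (\<phi> ` {1..n-2})"
    and "span (\<phi> ` {1..n-2}) = UNIV"
    and "\<And>k. k \<in> {1..n-2} \<Longrightarrow> \<omega> k = sqrt (- \<mu> k)"
    and "is_interval T" and "0 \<in> T" and "T \<noteq> {0}"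
  shows "(\<forall>U :: real \<Rightarrow> real^'p^'m.
            solves_flow A T U \<longleftrightarrow>
            (\<exists>C D. \<forall>t\<in>T. U t = mode_sum (n-2) \<omega> \<phi> C D t)) \<and>
         (\<forall>U0 V0 :: real^'p^'m.
            \<exists>!(C, D). C \<in> {1..n-2} \<rightarrow>\<^sub>E UNIV \<and> D \<in> {1..n-2} \<rightarrow>\<^sub>E UNIV \<and>
              (\<forall>U :: real \<Rightarrow> real^'p^'m.
                 solves_flow A T U \<and> U 0 = U0 \<and> (U has_vector_derivative V0) (at 0 within T) \<longleftrightarrow>
                 (\<forall>t\<in>T. U t = mode_sum (n-2) \<omega> \<phi> C D t)))"
proof -
  have neg: "\<mu> k < 0" if "k \<in> {1..n-2}" for k
  proof (rule tridiag_eigenvalue_negative[OF assms(3)])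
    show "tridiag label 1 (-2) 1 *v \<phi> k = \<mu> k *\<^sub>R \<phi> k"
      using assms(4,5) that by simp
    show "\<phi> k \<noteq> 0"
      using assms(7) that dependent_zero[of "\<phi> ` {1..n-2}"] by force
  qed
  interpret oscillation_modes A \<omega> \<phi> "n - 2"
    using neg assms(5-9) by unfold_locales (auto simp: less_imp_le)
  \<comment> \<open>A nondegenerate interval has 0 as a limit point, which makes derivatives within it unique.\<close>
  have "convex T"
    using assms(10) is_interval_convex by blast
  obtain s where s: "s \<in> T" "s \<noteq> 0"
    using assms(11,12) by blast
  have "connected T"
    using \<open>convex T\<close> convex_connected by blast
  then have "at 0 within T \<noteq> bot"
    using s \<open>0 \<in> T\<close> connected_imp_perfect[of T 0] by (auto simp: trivial_limit_within)
  then show ?thesis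
    by (intro conjI allI solves_flow_iff_mode_sum amplitudes_determined_by_initial_data
        \<open>convex T\<close> \<open>0 \<in> T\<close>)
qed

end
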